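(* Let $\alpha,\beta,b,c,z,p\in\mathbb{C}$ with $\mathrm{Re}(\alpha)>-1$, with $\mathrm{Re}(p)>0$ or $p=0$, and with $\mathrm{Re}(c)>\mathrm{Re}(b)>0$. Then for every $n\in\mathbb{N}$, $$\frac{d^{n}}{dz^{n}}\left\lbrace {}^{\Psi}\Phi_{p}^{(\alpha,\beta)}(b;c;z)\right\rbrace =\frac{(b)_{n}}{(c)_{n}}\;{}^{\Psi}\Phi_{p}^{(\alpha,\beta)}(b+n;c+n;z).$$
   Context: For $\alpha,\beta\in\mathbb{C}$ with $\mathrm{Re}(\alpha)>-1$, the Wright function is ${}_{0}\Psi_{1}(\alpha,\beta;z)=\sum_{n=0}^{\infty}\frac{1}{\Gamma(\alpha n+\beta)}\frac{z^n}{n!}$ (with $1/\Gamma$ equal to $0$ at the poles of $\Gamma$). The $\Psi$-beta function is, for $\mathrm{Re}(x)>0$, $\mathrm{Re}(y)>0$ and $\mathrm{Re}(p)>0$ (or $p=0$, by the same formula), $${}^{\Psi}B_{p}^{(\alpha,\beta)}(x,y)=\int_{0}^{1}t^{x-1}(1-t)^{y-1}\,{}_{0}\Psi_{1}\left(\alpha,\beta;-\frac{p}{t(1-t)}\right)dt.$$ The $\Psi$-confluent hypergeometric function is $${}^{\Psi}\Phi_{p}^{(\alpha,\beta)}(b;c;z)=\sum_{n=0}^{\infty}\frac{{}^{\Psi}B_{p}^{(\alpha,\beta)}(b+n,c-b)}{B(b,c-b)}\frac{z^{n}}{n!}.$$ Here $B$ is the classical beta function and $(\lambda)_0=1$, $(\lambda)_n=\Gamma(\lambda+n)/\Gamma(\lambda)=\lambda(\lambda+1)\cdots(\lambda+n-1)$.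 *)

theory Defs
  imports "HOL-Analysis.Analysis"
begin

text \<open>
  The library function \<^const>\<open>rGamma\<close> is the entire function $1/\Gamma$, which is $0$ at
  the poles of $\Gamma$.
\<close>

definition wright_psi :: "complex \<Rightarrow> complex \<Rightarrow> complex \<Rightarrow> complex" where
  "wright_psi \<alpha> \<beta> z = (\<Sum>n. rGamma (\<alpha> * of_nat n + \<beta>) * (z ^ n / fact n))"

text \<open>
  The integral is the Henstock--Kurzweil integral, which subsumes both the Lebesgue integral and
  convergent improper Riemann integrals. The values of the integrand at the two end points, where
  the formula involves a division by zero, do not affect it.
\<close>

definition psi_beta :: "complex \<Rightarrow> complex \<Rightarrow> complex \<Rightarrow> complex \<Rightarrow> complex \<Rightarrow> complex" where
  "psi_beta \<alpha> \<beta> p x y =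
     integral {0..1} (\<lambda>t::real. of_real t powr (x - 1) * of_real (1 - t) powr (y - 1) *
                        wright_psi \<alpha> \<beta> (- p / of_real (t * (1 - t))))"

definition psi_confluent ::
    "complex \<Rightarrow> complex \<Rightarrow> complex \<Rightarrow> complex \<Rightarrow> complex \<Rightarrow> complex \<Rightarrow> complex" where
  "psi_confluent \<alpha> \<beta> p b c z =
     (\<Sum>n. psi_beta \<alpha> \<beta> p (b + of_nat n) (c - b) / Beta b (c - b) * (z ^ n / fact n))"

end

theory Submission
  imports Defs
begin

text \<open>
  As a function of \<open>z\<close>, the \<open>\<Psi>\<close>-confluent function is an exponential generating function
  \<open>\<Sum>m. a m * z ^ m / m!\<close> whose coefficients are, up to the constant factor \<open>1 / B(b, c - b)\<close>, the
  moments \<open>\<integral>\<^sub>0\<^sup>1 t ^ m f(t) dt\<close> of one fixed function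
  \<open>f(t) = t\<^bsup>b-1\<^esup> (1 - t)\<^bsup>c-b-1\<^esup> \<^sub>0\<Psi>\<^sub>1(\<alpha>, \<beta>; -p / (t (1 - t)))\<close>. Differentiating such a series shifts
  the coefficients by one, and the shift \<open>b \<mapsto> b + n, c \<mapsto> c + n\<close> of the parameters also shifts the
  moments by \<open>n\<close>, because it leaves \<open>c - b\<close> fixed. The two sides then differ only in the
  normalisation, and \<open>B(b + n, c - b) / B(b, c - b) = (b)\<^sub>n / (c)\<^sub>n\<close>.

  The analytic content is that the series may be differentiated term by term everywhere, for which
  bounded coefficients suffice (\<open>deriv_funpow_exp_series\<close>). The Wright function can grow
  exponentially as \<open>t\<close> approaches the end points, so absolute convergence of the moment integrals
  cannot be relied upon, and some or all of them may fail to exist. The moments are nevertheless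
  bounded (\<open>moments_bounded\<close>): a moment that does not exist has the value \<open>0\<close>, and as soon as one
  moment exists, the second mean value theorem bounds all the later ones by means of the indefinite
  integral of its integrand.
\<close>

section \<open>Boundedness of moments\<close>

text \<open>
  The factor \<open>t ^ m\<close> increases from at least \<open>0\<close> to \<open>1\<close>, so by the second mean value theorem each
  moment is a combination of integrals of \<open>f\<close> over subintervals with weights in \<open>[0, 1]\<close>; these
  integrals depend continuously on the end point. The trivial bound \<open>\<integral>\<bar>f\<bar>\<close> is not available for a
  conditionally convergent integral.
\<close>
lemma moments_bounded_real:
  fixes f :: "real \<Rightarrow> real"
  assumes f: "f integrable_on {0..1}"
  shows "\<exists>C. \<forall>m. \<bar>integral {0..1} (\<lambda>t. t ^ m * f t)\<bar> \<le> C"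
proof -
  have "bounded ((\<lambda>c. integral {0..c} f) ` {0..1})"
    by (intro compact_imp_bounded compact_continuous_image indefinite_integral_continuous_1 f
        compact_Icc)
  then obtain A where A: "\<And>c. c \<in> {0..1} \<Longrightarrow> \<bar>integral {0..c} f\<bar> \<le> A"
    unfolding bounded_iff real_norm_def by blast
  have "bounded ((\<lambda>c. integral {c..1} f) ` {0..1})"
    by (intro compact_imp_bounded compact_continuous_image indefinite_integral_continuous_1' f
        compact_Icc)
  then obtain B where B: "\<And>c. c \<in> {0..1} \<Longrightarrow> \<bar>integral {c..1} f\<bar> \<le> B"
    unfolding bounded_iff real_norm_def by blast
  have "\<bar>integral {0..1} (\<lambda>t. t ^ m * f t)\<bar> \<le> A + B" for m
  proof -
    obtain c where c: "c \<in> {0..1}" and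
      eq: "integral {0..1} (\<lambda>t. t ^ m * f t) = 0 ^ m * integral {0..c} f + 1 ^ m * integral {c..1} f"
      using second_mean_value_theorem[of f 0 1 "\<lambda>t. t ^ m"] f by (auto intro: power_mono)
    have "\<bar>0 ^ m * integral {0..c} f\<bar> \<le> \<bar>integral {0..c} f\<bar>"
      by (cases m) auto
    then show ?thesis
      using A[OF c] B[OF c] unfolding eq by simp
  qed
  then show ?thesis by blast
qed

text \<open>
  Every moment beyond the first existing one, of order \<open>N\<close>, is a moment of the integrable function
  \<open>t ^ N f(t)\<close>, to which the previous lemma applies in each coordinate; the finitely many earlier
  ones are \<open>0\<close> by convention.
\<close>
lemma moments_bounded:
  fixes f :: "real \<Rightarrow> 'a::euclidean_space"
  shows "\<exists>C. \<forall>m. norm (integral {0..1} (\<lambda>t. t ^ m *\<^sub>R f t)) \<le> C"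
proof (cases "\<exists>m. (\<lambda>t. t ^ m *\<^sub>R f t) integrable_on {0..1}")
  case False
  then have "norm (integral {0..1} (\<lambda>t. t ^ m *\<^sub>R f t)) \<le> 0" for m
    by (simp add: not_integrable_integral)
  then show ?thesis by blast
next
  case True
  define N where "N = (LEAST m. (\<lambda>t. t ^ m *\<^sub>R f t) integrable_on {0..1})"
  have N: "(\<lambda>t. t ^ N *\<^sub>R f t) integrable_on {0..1}"
    unfolding N_def using True by (rule LeastI_ex)
  have "\<exists>C. \<forall>m. \<bar>integral {0..1} (\<lambda>t. t ^ m * ((t ^ N *\<^sub>R f t) \<bullet> i))\<bar> \<le> C" for i
    by (intro moments_bounded_real integrable_component N)
  then obtain C where
    C: "\<And>i m. \<bar>integral {0..1} (\<lambda>t. t ^ m * ((t ^ N *\<^sub>R f t) \<bullet> i))\<bar> \<le> C i"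
    by metis
  have C_nonneg: "0 \<le> sum C Basis"
    by (intro sum_nonneg) (meson C abs_ge_zero order_trans)
  have "norm (integral {0..1} (\<lambda>t. t ^ n *\<^sub>R f t)) \<le> sum C Basis" for n
  proof (cases "(\<lambda>t. t ^ n *\<^sub>R f t) integrable_on {0..1}")
    case False
    then show ?thesis using C_nonneg by (simp add: not_integrable_integral)
  next
    case n: True
    then have "N \<le> n" unfolding N_def by (rule Least_le)
    then have n_eq: "n = (n - N) + N" by simp
    have "\<bar>integral {0..1} (\<lambda>t. t ^ n *\<^sub>R f t) \<bullet> i\<bar> \<le> C i" for i
    proof -
      have "integral {0..1} (\<lambda>t. t ^ n *\<^sub>R f t) \<bullet> i = integral {0..1} (\<lambda>t. (t ^ n *\<^sub>R f t) \<bullet> i)"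
        by (rule integral_component_eq[symmetric, OF n])
      also have "(\<lambda>t. (t ^ n *\<^sub>R f t) \<bullet> i) = (\<lambda>t. t ^ (n - N) * ((t ^ N *\<^sub>R f t) \<bullet> i))"
        by (subst n_eq, subst power_add) (simp add: mult.assoc)
      finally show ?thesis using C by simp
    qed
    then show ?thesis
      by (intro order_trans[OF norm_le_l1] sum_mono)
  qed
  then show ?thesis by blast
qed

section \<open>Exponential generating functions with bounded coefficients\<close>

lemma summable_exp_series:
  fixes a :: "nat \<Rightarrow> complex"
  assumes "\<And>m. norm (a m) \<le> C"
  shows "summable (\<lambda>m. a m * (z ^ m / fact m))"
proof (rule summable_comparison_test')
  show "summable (\<lambda>m. C * (norm z ^ m / fact m))"
    using summable_exp[of "norm z"] by (intro summable_mult) (simp add: field_simps)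
  show "norm (a m * (z ^ m / fact m)) \<le> C * (norm z ^ m / fact m)" for m
    using assms[of m] by (simp add: norm_mult norm_divide norm_power divide_right_mono mult_right_mono)
qed

lemma exp_series_has_derivative:
  fixes a :: "nat \<Rightarrow> complex"
  assumes "\<And>m. norm (a m) \<le> C"
  shows "((\<lambda>z. \<Sum>m. a m * (z ^ m / fact m)) has_field_derivative
           (\<Sum>m. a (Suc m) * (z ^ m / fact m))) (at z)"
proof -
  have "diffs (\<lambda>m. a m / fact m) = (\<lambda>m. a (Suc m) / fact m)"
    by (simp add: diffs_def fun_eq_iff divide_simps del: of_nat_Suc)
  moreover have "summable (\<lambda>m. a m / fact m * y ^ m)" for y
    using summable_exp_series[where z = y, OF assms] by simp
  ultimately show ?thesis
    using termdiffs_strong_converges_everywhere[of "\<lambda>m. a m / fact m" z] by simp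
qed

lemma deriv_funpow_exp_series:
  fixes a :: "nat \<Rightarrow> complex"
  assumes "\<And>m. norm (a m) \<le> C"
  shows "(deriv ^^ k) (\<lambda>z. \<Sum>m. a m * (z ^ m / fact m)) = (\<lambda>z. \<Sum>m. a (m + k) * (z ^ m / fact m))"
proof (induction k)
  case (Suc k)
  have "deriv (\<lambda>z. \<Sum>m. a (m + k) * (z ^ m / fact m)) z = (\<Sum>m. a (m + Suc k) * (z ^ m / fact m))"
    for z
    using DERIV_imp_deriv[OF exp_series_has_derivative[of "\<lambda>m. a (m + k)", OF assms]] by simp
  then show ?case unfolding funpow.simps o_apply Suc.IH by (rule ext)
qed simp

section \<open>The parameter shift\<close>

lemma psi_beta_bounded: "\<exists>C. \<forall>m. norm (psi_beta \<alpha> \<beta> p (x + of_nat m) y) \<le> C"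
proof -
  define f where "f t = of_real t powr (x - 1) * of_real (1 - t) powr (y - 1) *
                          wright_psi \<alpha> \<beta> (- p / of_real (t * (1 - t)))" for t :: real
  \<comment> \<open>At \<open>t = 0\<close> both sides vanish, since \<open>0 powr w = 0\<close> for every \<open>w\<close>.\<close>
  have "of_real t powr (x + of_nat m - 1) = (of_real t ^ m * of_real t powr (x - 1) :: complex)"
    for t :: real and m
  proof (cases "t = 0")
    case False
    have "x + of_nat m - 1 = of_nat m + (x - 1)" by simp
    then show ?thesis
      using False by (simp only: powr_add) (simp add: powr_nat')
  qed simp
  then have "psi_beta \<alpha> \<beta> p (x + of_nat m) y = integral {0..1} (\<lambda>t. t ^ m *\<^sub>R f t)" for m
    by (simp add: psi_beta_def f_def scaleR_conv_of_real mult.assoc)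
  then show ?thesis using moments_bounded[of f] by simp
qed

lemma pos_Re_not_nonpos_Int: "0 < Re x \<Longrightarrow> x \<notin> \<int>\<^sub>\<le>\<^sub>0"
  by (auto elim!: nonpos_Ints_cases)

lemma Beta_nonzero:
  fixes x y :: complex
  assumes "0 < Re x" "0 < Re y"
  shows "Beta x y \<noteq> 0"
  using assms pos_Re_not_nonpos_Int[of x] pos_Re_not_nonpos_Int[of y]
    pos_Re_not_nonpos_Int[of "x + y"]
  by (simp add: Beta_def Gamma_eq_zero_iff)

lemma Beta_shift_left:
  fixes x y :: complex
  assumes "0 < Re x" "0 < Re y"
  shows "Beta (x + of_nat n) y = pochhammer x n / pochhammer (x + y) n * Beta x y"
proof -
  have nonpos: "x \<notin> \<int>\<^sub>\<le>\<^sub>0" "x + y \<notin> \<int>\<^sub>\<le>\<^sub>0"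
    using assms by (auto intro!: pos_Re_not_nonpos_Int)
  then have "Gamma x \<noteq> 0" "Gamma (x + y) \<noteq> 0"
    by (simp_all add: Gamma_eq_zero_iff)
  then show ?thesis
    using nonpos by (simp add: Beta_def pochhammer_Gamma add_ac)
qed

theorem theorem3p4:
  fixes \<alpha> \<beta> b c z p :: complex and n :: nat
  assumes "Re \<alpha> > -1"
    and "Re p > 0 \<or> p = 0"
    and "Re c > Re b" and "Re b > 0"
  shows "(\<forall>k<n. (deriv ^^ k) (psi_confluent \<alpha> \<beta> p b c) field_differentiable (at z)) \<and>
         (deriv ^^ n) (psi_confluent \<alpha> \<beta> p b c) z =
           pochhammer b n / pochhammer c n *
             psi_confluent \<alpha> \<beta> p (b + of_nat n) (c + of_nat n) z"
proof -
  define a where "a m = psi_beta \<alpha> \<beta> p (b + of_nat m) (c - b) / Beta b (c - b)" for m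
  obtain C where "\<And>m. norm (psi_beta \<alpha> \<beta> p (b + of_nat m) (c - b)) \<le> C"
    using psi_beta_bounded by blast
  then have a_bounded: "norm (a m) \<le> C / norm (Beta b (c - b))" for m
    unfolding a_def norm_divide by (intro divide_right_mono) auto
  have "psi_confluent \<alpha> \<beta> p b c = (\<lambda>z. \<Sum>m. a m * (z ^ m / fact m))"
    by (simp add: psi_confluent_def a_def fun_eq_iff)
  then have derivs: "(deriv ^^ k) (psi_confluent \<alpha> \<beta> p b c) =
      (\<lambda>z. \<Sum>m. a (m + k) * (z ^ m / fact m))" for k
    using deriv_funpow_exp_series[of a, OF a_bounded] by simp
  have "(deriv ^^ k) (psi_confluent \<alpha> \<beta> p b c) field_differentiable (at z)" for k
    unfolding derivs field_differentiable_def
    using exp_series_has_derivative[of "\<lambda>m. a (m + k)", OF a_bounded] by blast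
  moreover have "(\<Sum>m. a (m + n) * (z ^ m / fact m)) =
      pochhammer b n / pochhammer c n * psi_confluent \<alpha> \<beta> p (b + of_nat n) (c + of_nat n) z"
  proof -
    define r where "r = pochhammer b n / pochhammer c n"
    have shift: "Beta (b + of_nat n) (c - b) = r * Beta b (c - b)"
      using Beta_shift_left[of b "c - b" n] assms by (simp add: r_def)
    moreover have "Beta (b + of_nat n) (c - b) \<noteq> 0"
      using assms by (intro Beta_nonzero) auto
    ultimately have "r \<noteq> 0" by auto
    define d where "d m = psi_beta \<alpha> \<beta> p (b + of_nat n + of_nat m) (c - b) /
                            Beta (b + of_nat n) (c - b)" for m
    have a_eq: "a (m + n) = r * d m" for m
      using \<open>r \<noteq> 0\<close> by (simp add: a_def d_def shift add_ac)
    have "summable (\<lambda>m. a (m + n) / r * (z ^ m / fact m))"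
      using a_bounded \<open>r \<noteq> 0\<close>
      by (intro summable_exp_series[where C = "C / norm (Beta b (c - b)) / norm r"])
        (simp only: norm_divide divide_right_mono norm_ge_zero)
    then have "summable (\<lambda>m. d m * (z ^ m / fact m))"
      using \<open>r \<noteq> 0\<close> by (simp add: a_eq)
    then have "(\<Sum>m. r * (d m * (z ^ m / fact m))) = r * (\<Sum>m. d m * (z ^ m / fact m))"
      by (rule suminf_mult)
    then show ?thesis
      unfolding psi_confluent_def r_def[symmetric] by (simp add: a_eq d_def mult.assoc)
  qed
  ultimately show ?thesis
    using derivs[of n] by simp
qed

end
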